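(* Let $A$ be an integral Poisson algebra over $\Bbbk$ with the abelian weight property and such that its Poisson semi-centre $A^{\mathrm{sc}}$ is a finitely generated $\Bbbk$-algebra. Then the following hold: (i) every nonzero Poisson ideal of $A^{\mathrm{sc}}$ contains a nonzero Poisson normal element of $A^{\mathrm{sc}}$; (ii) every rational Casimir of $A^{\mathrm{sc}}$ is a quotient of two Poisson normal elements of $A^{\mathrm{sc}}$ weighted by the same derivation, i.e. for every $q$ in the Poisson centre of $\operatorname{Frac}(A^{\mathrm{sc}})$ there exist a Poisson derivation $\lambda$ of $A^{\mathrm{sc}}$ and elements $a,b \in A^{\mathrm{sc}}$ with $b\neq 0$, $\{c,a\}=\lambda(c)a$ and $\{c,b\}=\lambda(c)b$ for all $c\in A^{\mathrm{sc}}$, and $q = ab^{-1}$.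
   Context: $\Bbbk$ is a field of characteristic zero. A Poisson algebra over $\Bbbk$ is a commutative associative unital $\Bbbk$-algebra with a $\Bbbk$-bilinear Lie bracket $\{\cdot,\cdot\}$ that is a derivation in each argument. It is integral if it is an integral domain. A Poisson ideal is an ideal $I$ of $A$ with $\{A,I\}\subseteq I$. An element $a\in A$ is Poisson normal (in $A$) if $\{A,a\}\subseteq Aa$. The Poisson semi-centre $A^{\mathrm{sc}}$ is the $\Bbbk$-subalgebra of $A$ generated by the Poisson normal elements of $A$. A Poisson derivation of $A$ is a $\Bbbk$-linear map $\lambda:A\to A$ that is a derivation both of the associative product and of the bracket; $\operatorname{Der}_{\mathcal P}(A)$ is the Lie algebra (under commutator) of Poisson derivations. For $\lambda\in \operatorname{Der}_{\mathcal P}(A)$ put $A_\lambda=\{a\in A \mid \{b,a\}=\lambda(b)a \text{ for all } b\in A\}$, and let $\Lambda(A)=\{\lambda\in\operatorname{Der}_{\mathcal P}(A)\mid A_\lambda\neq 0\}$. $A$ has the abelian weight property if $[\lambda,\mu]=0$ for all $\lambda,\mu\in\Lambda(A)$; in that case $A^{\mathrm{sc}}$ is a Poisson subalgebra of $A$. The bracket of an integral Poisson algebra $B$ extends uniquely to a Poisson bracket on its fraction field $\operatorname{Frac}(B)$; the Poisson centre of a Poisson algebra is the set of elements whose bracket with every element is zero (such elements are called Casimirs), and a rational Casimir of $B$ is an element of the Poisson centre of $\operatorname{Frac}(B)$. *)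

theory Defs
  imports "HOL-Computational_Algebra.Polynomial_Factorial"
begin

text \<open>
  All structures are carrier sets inside an ambient commutative algebra type, so that an algebra
  \<open>A\<close>, its subalgebra \<open>A\<^sup>s\<^sup>c\<close> and the fraction field of that subalgebra are instances of the same
  notions. Taking the carrier to be \<open>UNIV\<close> gives the case where the type itself is the algebra.
  Maps such as brackets and derivations are only ever constrained on the carrier.
\<close>

locale commutative_algebra = vector_space scale
  for scale :: "'k::field \<Rightarrow> 'a::comm_ring_1 \<Rightarrow> 'a" +
  assumes scale_mult_left: "scale c a * b = scale c (a * b)"

definition subalgebra :: "('k::field \<Rightarrow> 'a::comm_ring_1 \<Rightarrow> 'a) \<Rightarrow> 'a set \<Rightarrow> bool" where
  "subalgebra scale B \<longleftrightarrow>
     module.subspace scale B \<and> 1 \<in> B \<and> (\<forall>x\<in>B. \<forall>y\<in>B. x * y \<in> B)"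

definition finitely_generated_algebra ::
    "('k::field \<Rightarrow> 'a::comm_ring_1 \<Rightarrow> 'a) \<Rightarrow> 'a set \<Rightarrow> bool" where
  "finitely_generated_algebra scale B \<longleftrightarrow> (\<exists>S. finite S \<and> B = subalgebra scale hull S)"

definition derivation_on ::
    "('k::field \<Rightarrow> 'a::comm_ring_1 \<Rightarrow> 'a) \<Rightarrow> 'a set \<Rightarrow> ('a \<Rightarrow> 'a) \<Rightarrow> bool" where
  "derivation_on scale B D \<longleftrightarrow>
     (\<forall>x\<in>B. D x \<in> B) \<and>
     (\<forall>x\<in>B. \<forall>y\<in>B. D (x + y) = D x + D y) \<and>
     (\<forall>c. \<forall>x\<in>B. D (scale c x) = scale c (D x)) \<and>
     (\<forall>x\<in>B. \<forall>y\<in>B. D (x * y) = D x * y + x * D y)"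

locale poisson_algebra = commutative_algebra scale
  for scale :: "'k::field_char_0 \<Rightarrow> 'a::comm_ring_1 \<Rightarrow> 'a"
    and br :: "'a \<Rightarrow> 'a \<Rightarrow> 'a" and A :: "'a set" +
  assumes subalgebra_carrier: "subalgebra scale A"
    and derivation_right: "a \<in> A \<Longrightarrow> derivation_on scale A (\<lambda>b. br a b)"
    and derivation_left: "b \<in> A \<Longrightarrow> derivation_on scale A (\<lambda>a. br a b)"
    and br_self: "a \<in> A \<Longrightarrow> br a a = 0"
    and jacobi: "\<lbrakk>a \<in> A; b \<in> A; c \<in> A\<rbrakk> \<Longrightarrow> br a (br b c) + br b (br c a) + br c (br a b) = 0"

locale integral_poisson_algebra = poisson_algebra scale br A
  for scale :: "'k::field_char_0 \<Rightarrow> 'a::idom \<Rightarrow> 'a"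
    and br :: "'a \<Rightarrow> 'a \<Rightarrow> 'a" and A :: "'a set"

definition poisson_ideal :: "('a::comm_ring_1 \<Rightarrow> 'a \<Rightarrow> 'a) \<Rightarrow> 'a set \<Rightarrow> 'a set \<Rightarrow> bool" where
  "poisson_ideal br A I \<longleftrightarrow>
     I \<subseteq> A \<and> 0 \<in> I \<and> (\<forall>x\<in>I. \<forall>y\<in>I. x + y \<in> I) \<and> (\<forall>a\<in>A. \<forall>x\<in>I. a * x \<in> I) \<and>
     (\<forall>a\<in>A. \<forall>x\<in>I. br a x \<in> I)"

definition poisson_normal :: "('a::comm_ring_1 \<Rightarrow> 'a \<Rightarrow> 'a) \<Rightarrow> 'a set \<Rightarrow> 'a \<Rightarrow> bool" where
  "poisson_normal br A a \<longleftrightarrow> a \<in> A \<and> (\<forall>b\<in>A. \<exists>c\<in>A. br b a = c * a)"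

definition poisson_semi_centre ::
    "('k::field \<Rightarrow> 'a::comm_ring_1 \<Rightarrow> 'a) \<Rightarrow> ('a \<Rightarrow> 'a \<Rightarrow> 'a) \<Rightarrow> 'a set \<Rightarrow> 'a set" where
  "poisson_semi_centre scale br A = subalgebra scale hull {a. poisson_normal br A a}"

definition poisson_derivation ::
    "('k::field \<Rightarrow> 'a::comm_ring_1 \<Rightarrow> 'a) \<Rightarrow> ('a \<Rightarrow> 'a \<Rightarrow> 'a) \<Rightarrow> 'a set \<Rightarrow> ('a \<Rightarrow> 'a) \<Rightarrow> bool" where
  "poisson_derivation scale br A l \<longleftrightarrow>
     derivation_on scale A l \<and> (\<forall>a\<in>A. \<forall>b\<in>A. l (br a b) = br (l a) b + br a (l b))"

definition weight_space ::
    "('a::comm_ring_1 \<Rightarrow> 'a \<Rightarrow> 'a) \<Rightarrow> 'a set \<Rightarrow> ('a \<Rightarrow> 'a) \<Rightarrow> 'a set" where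
  "weight_space br A l = {a \<in> A. \<forall>b\<in>A. br b a = l b * a}"

definition poisson_weights ::
    "('k::field \<Rightarrow> 'a::comm_ring_1 \<Rightarrow> 'a) \<Rightarrow> ('a \<Rightarrow> 'a \<Rightarrow> 'a) \<Rightarrow> 'a set \<Rightarrow> ('a \<Rightarrow> 'a) set" where
  "poisson_weights scale br A = {l. poisson_derivation scale br A l \<and> weight_space br A l \<noteq> {0}}"

definition abelian_weight_property ::
    "('k::field \<Rightarrow> 'a::comm_ring_1 \<Rightarrow> 'a) \<Rightarrow> ('a \<Rightarrow> 'a \<Rightarrow> 'a) \<Rightarrow> 'a set \<Rightarrow> bool" where
  "abelian_weight_property scale br A \<longleftrightarrow>
     (\<forall>l\<in>poisson_weights scale br A. \<forall>m\<in>poisson_weights scale br A.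
        \<forall>a\<in>A. l (m a) - m (l a) = 0)"

definition poisson_centre :: "('a::comm_ring_1 \<Rightarrow> 'a \<Rightarrow> 'a) \<Rightarrow> 'a set \<Rightarrow> 'a set" where
  "poisson_centre br A = {z \<in> A. \<forall>a\<in>A. br a z = 0}"

text \<open>
  For a subring \<open>B\<close> of an integral domain, \<open>Frac B\<close> is realised as the subfield of the fraction
  field of the ambient domain consisting of the quotients of elements of \<open>B\<close>.
\<close>

definition frac_carrier :: "'a::idom set \<Rightarrow> 'a fract set" where
  "frac_carrier B = {to_fract a / to_fract b | a b. a \<in> B \<and> b \<in> B \<and> b \<noteq> 0}"

definition frac_scale :: "('k::field \<Rightarrow> 'a::idom \<Rightarrow> 'a) \<Rightarrow> 'k \<Rightarrow> 'a fract \<Rightarrow> 'a fract" where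
  "frac_scale scale c q = to_fract (scale c 1) * q"

definition frac_bracket_of ::
    "('k::field_char_0 \<Rightarrow> 'a::idom \<Rightarrow> 'a) \<Rightarrow> ('a \<Rightarrow> 'a \<Rightarrow> 'a) \<Rightarrow> 'a set \<Rightarrow>
     ('a fract \<Rightarrow> 'a fract \<Rightarrow> 'a fract) \<Rightarrow> bool" where
  "frac_bracket_of scale br B F \<longleftrightarrow>
     poisson_algebra (frac_scale scale) F (frac_carrier B) \<and>
     (\<forall>a\<in>B. \<forall>b\<in>B. F (to_fract a) (to_fract b) = to_fract (br a b)) \<and>
     (\<forall>p q. p \<notin> frac_carrier B \<or> q \<notin> frac_carrier B \<longrightarrow> F p q = 0)"

text \<open>
  The unique Poisson bracket on \<open>Frac B\<close> extending that of \<open>B\<close>; the values outside the carrier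
  are fixed to 0 so that it is unique as a total function. Existence and uniqueness are
  proved in \<open>frac_bracket_ex1\<close> below.
\<close>

definition frac_bracket ::
    "('k::field_char_0 \<Rightarrow> 'a::idom \<Rightarrow> 'a) \<Rightarrow> ('a \<Rightarrow> 'a \<Rightarrow> 'a) \<Rightarrow> 'a set \<Rightarrow>
     ('a fract \<Rightarrow> 'a fract \<Rightarrow> 'a fract)" where
  "frac_bracket scale br B = (THE F. frac_bracket_of scale br B F)"

definition rational_casimirs ::
    "('k::field_char_0 \<Rightarrow> 'a::idom \<Rightarrow> 'a) \<Rightarrow> ('a \<Rightarrow> 'a \<Rightarrow> 'a) \<Rightarrow> 'a set \<Rightarrow> 'a fract set" where
  "rational_casimirs scale br B = poisson_centre (frac_bracket scale br B) (frac_carrier B)"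


subsection \<open>Existence and uniqueness of the bracket on the fraction field\<close>

context poisson_algebra
begin

lemma carrier_zero: "0 \<in> A" and carrier_one: "1 \<in> A"
  and carrier_add: "\<lbrakk>x \<in> A; y \<in> A\<rbrakk> \<Longrightarrow> x + y \<in> A"
  and carrier_scale: "x \<in> A \<Longrightarrow> scale c x \<in> A"
  and carrier_mult: "\<lbrakk>x \<in> A; y \<in> A\<rbrakk> \<Longrightarrow> x * y \<in> A"
  using subalgebra_carrier by (auto simp: subalgebra_def subspace_def)

lemma carrier_uminus: "x \<in> A \<Longrightarrow> - x \<in> A"
  using carrier_scale[of x "-1"] by simp

lemma br_closed: "\<lbrakk>a \<in> A; b \<in> A\<rbrakk> \<Longrightarrow> br a b \<in> A"
  and br_add_right: "\<lbrakk>a \<in> A; b \<in> A; c \<in> A\<rbrakk> \<Longrightarrow> br a (b + c) = br a b + br a c"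
  and br_mult_right: "\<lbrakk>a \<in> A; b \<in> A; c \<in> A\<rbrakk> \<Longrightarrow> br a (b * c) = br a b * c + b * br a c"
  and br_scale_right: "\<lbrakk>a \<in> A; b \<in> A\<rbrakk> \<Longrightarrow> br a (scale k b) = scale k (br a b)"
  using derivation_right by (auto simp: derivation_on_def)

lemma br_add_left: "\<lbrakk>a \<in> A; b \<in> A; c \<in> A\<rbrakk> \<Longrightarrow> br (a + b) c = br a c + br b c"
  and br_mult_left: "\<lbrakk>a \<in> A; b \<in> A; c \<in> A\<rbrakk> \<Longrightarrow> br (a * b) c = br a c * b + a * br b c"
  and br_scale_left: "\<lbrakk>a \<in> A; b \<in> A\<rbrakk> \<Longrightarrow> br (scale k a) b = scale k (br a b)"
  using derivation_left by (auto simp: derivation_on_def)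

lemma br_antisym: assumes "a \<in> A" "b \<in> A" shows "br b a = - br a b"
proof -
  have "br a b + br b a = 0"
    using br_self[OF carrier_add[OF assms]] assms
    by (simp add: br_add_left br_add_right br_self[OF assms(1)] br_self[OF assms(2)] carrier_add
        add.commute)
  then show ?thesis by (simp add: add_eq_0_iff)
qed

lemma br_one: "a \<in> A \<Longrightarrow> br a 1 = 0"
  using br_mult_right[of a 1 1] by (simp add: carrier_one)

end

context integral_poisson_algebra
begin

abbreviation FA where "FA \<equiv> frac_carrier A"

lemma FA_I: "\<lbrakk>a \<in> A; b \<in> A; b \<noteq> 0\<rbrakk> \<Longrightarrow> to_fract a / to_fract b \<in> FA"
  by (auto simp: frac_carrier_def)

lemma FA_E:
  assumes "p \<in> FA"
  obtains a b where "a \<in> A" "b \<in> A" "b \<noteq> 0" "p = to_fract a / to_fract b"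
  using assms by (auto simp: frac_carrier_def)

lemma FA_to_fract: "a \<in> A \<Longrightarrow> to_fract a \<in> FA"
  using FA_I[of a 1] by (simp add: carrier_one)

lemma FA_add: assumes "p \<in> FA" "q \<in> FA" shows "p + q \<in> FA"
proof -
  obtain a b where p: "a \<in> A" "b \<in> A" "b \<noteq> 0" "p = to_fract a / to_fract b"
    using assms(1) by (rule FA_E)
  obtain c d where q: "c \<in> A" "d \<in> A" "d \<noteq> 0" "q = to_fract c / to_fract d"
    using assms(2) by (rule FA_E)
  have "p + q = to_fract (a * d + c * b) / to_fract (b * d)"
    using p q by (simp add: field_simps)
  then show ?thesis
    using p q FA_I[of "a * d + c * b" "b * d"] by (simp add: carrier_add carrier_mult)
qed

lemma FA_mult: assumes "p \<in> FA" "q \<in> FA" shows "p * q \<in> FA"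
proof -
  obtain a b where p: "a \<in> A" "b \<in> A" "b \<noteq> 0" "p = to_fract a / to_fract b"
    using assms(1) by (rule FA_E)
  obtain c d where q: "c \<in> A" "d \<in> A" "d \<noteq> 0" "q = to_fract c / to_fract d"
    using assms(2) by (rule FA_E)
  have "p * q = to_fract (a * c) / to_fract (b * d)"
    using p q by (simp add: field_simps)
  then show ?thesis
    using p q FA_I[of "a * c" "b * d"] by (simp add: carrier_mult)
qed

lemma FA_uminus: assumes "p \<in> FA" shows "- p \<in> FA"
  using FA_mult[OF FA_to_fract[of "-1"] assms] by (simp add: carrier_uminus carrier_one)

lemma FA_diff: "\<lbrakk>p \<in> FA; q \<in> FA\<rbrakk> \<Longrightarrow> p - q \<in> FA"
  using FA_add[of p "- q"] FA_uminus[of q] by simp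

lemma FA_div: assumes "p \<in> FA" "b \<in> A" "b \<noteq> 0" shows "p / to_fract b \<in> FA"
  using FA_mult[OF assms(1) FA_I[of 1 b]] assms by (simp add: carrier_one)

definition fder :: "('a \<Rightarrow> 'a fract) \<Rightarrow> bool" where
  "fder D \<longleftrightarrow> (\<forall>x\<in>A. \<forall>y\<in>A. D (x + y) = D x + D y \<and>
     D (x * y) = D x * to_fract y + to_fract x * D y)"

definition fext :: "('a \<Rightarrow> 'a fract) \<Rightarrow> 'a fract \<Rightarrow> 'a fract" where
  "fext D p = (let r = (SOME r. fst r \<in> A \<and> snd r \<in> A \<and> snd r \<noteq> 0 \<and>
       p = to_fract (fst r) / to_fract (snd r))
     in (D (fst r) - p * D (snd r)) / to_fract (snd r))"

lemma fext_eq: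
  assumes D: "fder D" and ab: "a \<in> A" "b \<in> A" "b \<noteq> 0" and p: "p = to_fract a / to_fract b"
  shows "fext D p = (D a - p * D b) / to_fract b"
proof -
  let ?P = "\<lambda>r. fst r \<in> A \<and> snd r \<in> A \<and> snd r \<noteq> 0 \<and>
       p = to_fract (fst r) / to_fract (snd r)"
  define r where "r = (SOME r. ?P r)"
  have "?P (a, b)" using assms by simp
  then have r: "?P r" unfolding r_def by (rule someI)
  obtain c d where cd: "r = (c, d)" by (cases r)
  have d: "c \<in> A" "d \<in> A" "d \<noteq> 0" "p = to_fract c / to_fract d" using r cd by auto
  have 1: "to_fract a = p * to_fract b" using p ab by simp
  have 2: "to_fract c = p * to_fract d" using d by simp
  have "to_fract (a * d) = to_fract (c * b)" using 1 2 by simp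
  then have "a * d = c * b" by (simp only: to_fract_eq_iff)
  then have "D (a * d) = D (c * b)" by simp
  then have "D a * to_fract d + to_fract a * D d = D c * to_fract b + to_fract c * D b"
    using D ab d by (simp add: fder_def)
  then have 3: "to_fract d * (D a - p * D b) = to_fract b * (D c - p * D d)"
    unfolding 1 2 by (simp add: algebra_simps)
  have "fext D p = (D c - p * D d) / to_fract d"
    by (simp add: fext_def r_def[symmetric] cd)
  also have "\<dots> = (D a - p * D b) / to_fract b"
    using 3 ab d by (simp add: frac_eq_eq mult.commute)
  finally show ?thesis .
qed

lemma fder_one: assumes "fder D" shows "D 1 = 0"
proof -
  have "D (1 * 1) = D 1 * to_fract 1 + to_fract 1 * D 1"
    using assms carrier_one unfolding fder_def by blast
  then show ?thesis by (metis add_cancel_right_right mult_1 mult_1_right to_fract_1)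
qed

lemma fext_to_fract: assumes "fder D" "a \<in> A" shows "fext D (to_fract a) = D a"
  using fext_eq[OF assms(1,2) carrier_one, of "to_fract a"] fder_one[OF assms(1)] by simp

lemma fext_add:
  assumes D: "fder D" and pq: "p \<in> FA" "q \<in> FA"
  shows "fext D (p + q) = fext D p + fext D q"
proof -
  obtain a b where p: "a \<in> A" "b \<in> A" "b \<noteq> 0" "p = to_fract a / to_fract b"
    using pq(1) by (rule FA_E)
  obtain c d where q: "c \<in> A" "d \<in> A" "d \<noteq> 0" "q = to_fract c / to_fract d"
    using pq(2) by (rule FA_E)
  have h: "to_fract a = p * to_fract b" "to_fract c = q * to_fract d" using p q by auto
  have n0: "to_fract b \<noteq> 0" "to_fract d \<noteq> 0" using p q by auto
  have e: "p + q = to_fract (a * d + c * b) / to_fract (b * d)"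
    using p q by (simp add: field_simps)
  have "fext D (p + q) = (D (a * d + c * b) - (p + q) * D (b * d)) / to_fract (b * d)"
    using p q by (intro fext_eq[OF D _ _ _ e]) (auto simp: carrier_add carrier_mult)
  also have "D (a * d + c * b) = D a * to_fract d + p * to_fract b * D d +
       (D c * to_fract b + q * to_fract d * D b)"
    using D p(1-3) q(1-3) by (simp add: fder_def carrier_mult h)
  also have "D (b * d) = D b * to_fract d + to_fract b * D d"
    using D p(1-3) q(1-3) by (simp add: fder_def)
  finally have "fext D (p + q) = (D a - p * D b) / to_fract b + (D c - q * D d) / to_fract d"
    using n0 by (simp add: field_simps)
  then show ?thesis
    using fext_eq[OF D p] fext_eq[OF D q] by simp
qed

lemma fext_mult:
  assumes D: "fder D" and pq: "p \<in> FA" "q \<in> FA"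
  shows "fext D (p * q) = fext D p * q + p * fext D q"
proof -
  obtain a b where p: "a \<in> A" "b \<in> A" "b \<noteq> 0" "p = to_fract a / to_fract b"
    using pq(1) by (rule FA_E)
  obtain c d where q: "c \<in> A" "d \<in> A" "d \<noteq> 0" "q = to_fract c / to_fract d"
    using pq(2) by (rule FA_E)
  have h: "to_fract a = p * to_fract b" "to_fract c = q * to_fract d" using p q by auto
  have n0: "to_fract b \<noteq> 0" "to_fract d \<noteq> 0" using p q by auto
  have e: "p * q = to_fract (a * c) / to_fract (b * d)"
    using p q by (simp add: field_simps)
  have "fext D (p * q) = (D (a * c) - (p * q) * D (b * d)) / to_fract (b * d)"
    using p q by (intro fext_eq[OF D _ _ _ e]) (auto simp: carrier_mult)
  also have "D (a * c) = D a * (q * to_fract d) + p * to_fract b * D c"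
    using D p(1-3) q(1-3) by (simp add: fder_def h)
  also have "D (b * d) = D b * to_fract d + to_fract b * D d"
    using D p(1-3) q(1-3) by (simp add: fder_def)
  finally have "fext D (p * q) =
      (D a - p * D b) / to_fract b * q + p * ((D c - q * D d) / to_fract d)"
    using n0 by (simp add: field_simps)
  then show ?thesis
    using fext_eq[OF D p] fext_eq[OF D q] by simp
qed

definition br1 :: "'a \<Rightarrow> 'a fract \<Rightarrow> 'a fract" where
  "br1 c p = fext (\<lambda>a. to_fract (br a c)) p"

definition br2 :: "'a fract \<Rightarrow> 'a fract \<Rightarrow> 'a fract" where
  "br2 p q = (if p \<in> FA \<and> q \<in> FA then fext (\<lambda>c. br1 c p) q else 0)"

lemma fder_br: "c \<in> A \<Longrightarrow> fder (\<lambda>a. to_fract (br a c))"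
  by (simp add: fder_def br_add_left br_mult_left)

lemma br1_eq:
  assumes "c \<in> A" "a \<in> A" "b \<in> A" "b \<noteq> 0" "p = to_fract a / to_fract b"
  shows "br1 c p = (to_fract (br a c) - p * to_fract (br b c)) / to_fract b"
  unfolding br1_def using assms fder_br by (intro fext_eq)

lemma fder_br1: assumes "p \<in> FA" shows "fder (\<lambda>c. br1 c p)"
proof -
  obtain a b where p: "a \<in> A" "b \<in> A" "b \<noteq> 0" "p = to_fract a / to_fract b"
    using assms by (rule FA_E)
  have n0: "to_fract b \<noteq> 0" using p by auto
  show ?thesis
    unfolding fder_def
    using p(1-3) n0
    by (auto simp: br1_eq[OF _ p] carrier_add carrier_mult br_add_right br_mult_right
        add_divide_distrib diff_divide_distrib algebra_simps)
qed

lemma br2_eq: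
  assumes p: "a \<in> A" "b \<in> A" "b \<noteq> 0" "p = to_fract a / to_fract b"
    and q: "c \<in> A" "d \<in> A" "d \<noteq> 0" "q = to_fract c / to_fract d"
  shows "br2 p q = (to_fract (br a c) - p * to_fract (br b c) - q * to_fract (br a d)
           + p * q * to_fract (br b d)) / to_fract b / to_fract d"
proof -
  have pF: "p \<in> FA" and qF: "q \<in> FA" using p q FA_I by auto
  have "br2 p q = (br1 c p - q * br1 d p) / to_fract d"
    using pF qF fext_eq[OF fder_br1[OF pF] q] by (simp add: br2_def)
  also have "br1 c p - q * br1 d p = (to_fract (br a c) - p * to_fract (br b c)
      - q * to_fract (br a d) + p * q * to_fract (br b d)) / to_fract b"
    unfolding br1_eq[OF q(1) p] br1_eq[OF q(2) p]
    by (simp add: diff_divide_distrib add_divide_distrib algebra_simps)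
  finally show ?thesis .
qed

lemma br2_closed: assumes "p \<in> FA" "q \<in> FA" shows "br2 p q \<in> FA"
proof -
  obtain a b where p: "a \<in> A" "b \<in> A" "b \<noteq> 0" "p = to_fract a / to_fract b"
    using assms(1) by (rule FA_E)
  obtain c d where q: "c \<in> A" "d \<in> A" "d \<noteq> 0" "q = to_fract c / to_fract d"
    using assms(2) by (rule FA_E)
  show ?thesis
    unfolding br2_eq[OF p q] using p(1-3) q(1-3) assms
    by (intro FA_div FA_add FA_diff FA_mult FA_to_fract br_closed)
qed

lemma br2_antisym: assumes "p \<in> FA" "q \<in> FA" shows "br2 q p = - br2 p q"
proof -
  obtain a b where p: "a \<in> A" "b \<in> A" "b \<noteq> 0" "p = to_fract a / to_fract b"
    using assms(1) by (rule FA_E)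
  obtain c d where q: "c \<in> A" "d \<in> A" "d \<noteq> 0" "q = to_fract c / to_fract d"
    using assms(2) by (rule FA_E)
  have "to_fract b \<noteq> 0" "to_fract d \<noteq> 0" using p q by auto
  then show ?thesis
    unfolding br2_eq[OF p q] br2_eq[OF q p]
    using p(1-3) q(1-3)
    by (simp add: br_antisym[of a] br_antisym[of b] divide_simps algebra_simps)
qed

lemma br2_self: assumes "p \<in> FA" shows "br2 p p = 0"
proof -
  obtain a b where p: "a \<in> A" "b \<in> A" "b \<noteq> 0" "p = to_fract a / to_fract b"
    using assms(1) by (rule FA_E)
  show ?thesis
    unfolding br2_eq[OF p p] using p(1-3) by (simp add: br_antisym[of a b] br_self)
qed

lemma br2_to_fract:
  assumes "a \<in> A" "b \<in> A" shows "br2 (to_fract a) (to_fract b) = to_fract (br a b)"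
  using assms br2_eq[of a 1 "to_fract a" b 1 "to_fract b"]
  by (simp add: carrier_one br_one br_antisym[of _ 1])

lemma br2_add_right:
  assumes "p \<in> FA" "q \<in> FA" "r \<in> FA" shows "br2 p (q + r) = br2 p q + br2 p r"
  using assms by (simp add: br2_def FA_add fext_add[OF fder_br1])

lemma br2_mult_right:
  assumes "p \<in> FA" "q \<in> FA" "r \<in> FA" shows "br2 p (q * r) = br2 p q * r + q * br2 p r"
  using assms by (simp add: br2_def FA_mult fext_mult[OF fder_br1])

lemma FA_vanish:
  assumes D: "\<And>x y. \<lbrakk>x \<in> FA; y \<in> FA\<rbrakk> \<Longrightarrow> D (x * y) = D x * y + x * D y"
    and 0: "\<And>a. a \<in> A \<Longrightarrow> D (to_fract a) = 0" and p: "p \<in> FA"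
  shows "D p = (0 :: 'a fract)"
proof -
  obtain a b where ab: "a \<in> A" "b \<in> A" "b \<noteq> 0" "p = to_fract a / to_fract b"
    using p by (rule FA_E)
  have "D (p * to_fract b) = D p * to_fract b"
    using D[OF p FA_to_fract[OF ab(2)]] 0[OF ab(2)] by simp
  moreover have "p * to_fract b = to_fract a" using ab by simp
  ultimately show ?thesis using 0[OF ab(1)] ab by simp
qed

definition jac :: "'a fract \<Rightarrow> 'a fract \<Rightarrow> 'a fract \<Rightarrow> 'a fract" where
  "jac p q r = br2 p (br2 q r) + br2 q (br2 r p) + br2 r (br2 p q)"

lemma br2_zero: "p \<in> FA \<Longrightarrow> br2 p 0 = 0"
  using br2_add_right[of p 0 0] FA_to_fract[OF carrier_zero]
  by (metis add_0 add_cancel_right_right to_fract_0)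

lemma br2_uminus_right: "\<lbrakk>p \<in> FA; q \<in> FA\<rbrakk> \<Longrightarrow> br2 p (- q) = - br2 p q"
  using br2_add_right[of p q "- q"] br2_zero[of p]
  by (simp add: FA_uminus add_eq_0_iff)

lemma jac_eq:
  assumes "p \<in> FA" "q \<in> FA" "r \<in> FA"
  shows "jac p q r = br2 p (br2 q r) - br2 q (br2 p r) - br2 (br2 p q) r"
  unfolding jac_def using assms
  by (simp add: br2_antisym[of p r] br2_antisym[of "br2 p q" r] br2_closed br2_uminus_right)

lemma jac_mult:
  assumes "p \<in> FA" "q \<in> FA" "x \<in> FA" "y \<in> FA"
  shows "jac p q (x * y) = jac p q x * y + x * jac p q y"
  using assms
  by (simp add: jac_eq FA_mult FA_add br2_closed br2_mult_right br2_add_right algebra_simps)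

lemma jac_to_fract:
  assumes "a \<in> A" "b \<in> A" "c \<in> A"
  shows "jac (to_fract a) (to_fract b) (to_fract c) = 0"
  using assms jacobi[OF assms]
  by (simp add: jac_def br2_to_fract br_closed flip: to_fract_add)

lemma jac_rotate: "jac p q r = jac q r p"
  by (simp add: jac_def)

lemma br2_jacobi:
  assumes "p \<in> FA" "q \<in> FA" "r \<in> FA" shows "jac p q r = 0"
proof -
  have 1: "jac (to_fract a) (to_fract b) r = 0" if "a \<in> A" "b \<in> A" "r \<in> FA" for a b r
    by (rule FA_vanish[where D = "jac (to_fract a) (to_fract b)"])
      (use that in \<open>auto simp: jac_mult jac_to_fract FA_to_fract\<close>)
  have 2: "jac (to_fract a) q r = 0" if a: "a \<in> A" and "q \<in> FA" "r \<in> FA" for a q r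
  proof -
    have "jac r (to_fract a) q = 0"
    proof (rule FA_vanish[where D = "jac r (to_fract a)"])
      show "jac r (to_fract a) (to_fract b) = 0" if "b \<in> A" for b
        unfolding jac_rotate[of r] using a that \<open>r \<in> FA\<close> by (rule 1)
    qed (use that in \<open>auto simp: jac_mult FA_to_fract\<close>)
    then show ?thesis using jac_rotate by metis
  qed
  show ?thesis
  proof (rule FA_vanish[where D = "jac p q"])
    show "jac p q (to_fract a) = 0" if "a \<in> A" for a
      using 2[OF that assms(1,2)] jac_rotate by metis
  qed (use assms in \<open>auto simp: jac_mult\<close>)
qed

lemma commutative_algebra_frac: "commutative_algebra (frac_scale scale)"
proof -
  have "scale a 1 * scale b 1 = scale (a * b) 1" for a b
    by (simp add: scale_mult_left)
  then show ?thesis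
    by unfold_locales
      (simp_all add: frac_scale_def algebra_simps scale_left_distrib flip: mult.assoc to_fract_mult)
qed

lemma derivation_br2: assumes p: "p \<in> FA" shows "derivation_on (frac_scale scale) FA (br2 p)"
proof -
  have "br2 p (to_fract (scale c 1)) = 0" for c
  proof -
    have c: "scale c 1 \<in> A" by (simp add: carrier_scale carrier_one)
    have "br2 (to_fract (scale c 1)) p = 0"
    proof (rule FA_vanish[OF _ _ p])
      show "br2 (to_fract (scale c 1)) (x * y) = br2 (to_fract (scale c 1)) x * y +
          x * br2 (to_fract (scale c 1)) y" if "x \<in> FA" "y \<in> FA" for x y
        using that c by (simp add: br2_mult_right FA_to_fract)
      show "br2 (to_fract (scale c 1)) (to_fract a) = 0" if "a \<in> A" for a
        using that c
        by (simp add: br2_to_fract br_scale_left carrier_one br_antisym[of a 1] br_one)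
    qed
    then show ?thesis using br2_antisym[of "to_fract (scale c 1)" p] p c FA_to_fract by simp
  qed
  then show ?thesis
    using p by (auto simp: derivation_on_def br2_closed br2_add_right br2_mult_right
        frac_scale_def FA_to_fract carrier_scale carrier_one)
qed

lemma frac_bracket_of_br2: "frac_bracket_of scale br A br2"
proof -
  interpret F: commutative_algebra "frac_scale scale" by (rule commutative_algebra_frac)
  have "poisson_algebra (frac_scale scale) br2 FA"
  proof unfold_locales
    show "subalgebra (frac_scale scale) FA"
      using FA_to_fract[OF carrier_zero] FA_to_fract[OF carrier_one]
      by (auto simp: subalgebra_def F.subspace_def FA_add FA_mult frac_scale_def
          FA_to_fract carrier_scale carrier_one)
    show "derivation_on (frac_scale scale) FA (\<lambda>b. br2 a b)" if "a \<in> FA" for a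
      using derivation_br2[OF that] by simp
    show "derivation_on (frac_scale scale) FA (\<lambda>a. br2 a b)" if b: "b \<in> FA" for b
    proof -
      have sF: "frac_scale scale c x \<in> FA" if "x \<in> FA" for c x
        using that by (simp add: frac_scale_def FA_mult FA_to_fract carrier_scale carrier_one)
      have d: "derivation_on (frac_scale scale) FA (br2 b)" by (rule derivation_br2[OF b])
      have e: "br2 a b = - br2 b a" if "a \<in> FA" for a
        using br2_antisym[OF b that] .
      show ?thesis
        using d unfolding derivation_on_def
        by (auto simp: e FA_add FA_mult sF FA_uminus)
    qed
    show "br2 a a = 0" if "a \<in> FA" for a using br2_self[OF that] .
    show "br2 a (br2 b c) + br2 b (br2 c a) + br2 c (br2 a b) = 0"
      if "a \<in> FA" "b \<in> FA" "c \<in> FA" for a b c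
      using br2_jacobi[OF that] by (simp add: jac_def)
  qed
  then show ?thesis
    unfolding frac_bracket_of_def by (auto simp: br2_to_fract) (auto simp: br2_def)
qed

theorem frac_bracket_ex1: "\<exists>!F. frac_bracket_of scale br A F"
proof (rule ex1I[where a = br2], rule frac_bracket_of_br2)
  fix F assume F: "frac_bracket_of scale br A F"
  then interpret F: poisson_algebra "frac_scale scale" F FA by (simp add: frac_bracket_of_def)
  have 1: "F (to_fract a) q - br2 (to_fract a) q = 0" if a: "a \<in> A" and q: "q \<in> FA" for a q
    by (rule FA_vanish[OF _ _ q])
      (use F a in \<open>auto simp: F.br_mult_right br2_mult_right FA_to_fract algebra_simps
          br2_to_fract frac_bracket_of_def\<close>)
  have 2: "F q p - br2 q p = 0" if q: "q \<in> FA" and p: "p \<in> FA" for p q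
  proof (rule FA_vanish[OF _ _ p])
    show "F q (x * y) - br2 q (x * y) = (F q x - br2 q x) * y + x * (F q y - br2 q y)"
      if "x \<in> FA" "y \<in> FA" for x y
      using that q by (simp add: F.br_mult_right br2_mult_right algebra_simps)
    show "F q (to_fract a) - br2 q (to_fract a) = 0" if a: "a \<in> A" for a
      using 1[OF a q] F.br_antisym[OF FA_to_fract[OF a] q] br2_antisym[OF FA_to_fract[OF a] q]
      by simp
  qed
  show "F = br2"
  proof (intro ext)
    fix p q
    show "F p q = br2 p q"
      using 2[of p q] F unfolding frac_bracket_of_def
      by (cases "p \<in> FA \<and> q \<in> FA") (auto simp: br2_def)
  qed
qed

end

end

(*
  The semi-centre is spanned by the Poisson normal elements of A, each of which has a weight.
  Commutativity of the weights gives l(A_m) <= A_m for all weights l, m. In a nonzero Poisson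
  ideal take a nonzero x = a_1 + ... + a_n with all a_i normal and n minimal. If a_i has weight
  l_i, then for every normal b the element {b,x} - l_1(b) x is the sum of the normal elements
  (l_i(b) - l_1(b)) a_i with i > 1, hence vanishes by minimality; so x has weight l_1 on the
  semi-centre. For a rational Casimir q, apply this to the Poisson ideal of denominators of q.
*)
theory Submission
  imports Defs
begin

section \<open>Bracket identities and Poisson normal elements over an arbitrary carrier\<close>

context poisson_algebra
begin

lemma carrier_diff: "\<lbrakk>x \<in> A; y \<in> A\<rbrakk> \<Longrightarrow> x - y \<in> A"
  using carrier_add[of x "- y"] carrier_uminus[of y] by simp

lemma br_diff_right: "\<lbrakk>a \<in> A; b \<in> A; c \<in> A\<rbrakk> \<Longrightarrow> br a (b - c) = br a b - br a c"
  using br_add_right[of a "b - c" c] by (simp add: carrier_diff)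

lemma br_zero_right: "a \<in> A \<Longrightarrow> br a 0 = 0"
  using br_diff_right[of a 0 0] carrier_zero by simp

lemma br_zero_left: "a \<in> A \<Longrightarrow> br 0 a = 0"
  using br_antisym[of a 0] br_zero_right carrier_zero by simp

text \<open>Jacobi solved for one term, so that \<open>br a\<close> acts as a derivation of the
  bracket; this is the form in which brackets with a normal element are iterated below.\<close>

lemma br_br: "\<lbrakk>a \<in> A; b \<in> A; c \<in> A\<rbrakk> \<Longrightarrow> br a (br b c) = br (br a b) c + br b (br a c)"
  using jacobi[of a b c] br_antisym[of a c] br_antisym[of c "br a b"]
    br_diff_right[of b 0 "br a c"] br_zero_right[of b]
  by (simp add: br_closed carrier_zero algebra_simps)

lemma weight_spaceD:
  assumes "a \<in> weight_space br A l" shows "a \<in> A" "b \<in> A \<Longrightarrow> br b a = l b * a"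
  using assms by (auto simp: weight_space_def)

lemma weight_space_diff:
  "\<lbrakk>a \<in> weight_space br A l; b \<in> weight_space br A l\<rbrakk> \<Longrightarrow> a - b \<in> weight_space br A l"
  by (auto simp: weight_space_def carrier_diff br_diff_right algebra_simps)

lemma poisson_normal_weight_space:
  assumes "l \<in> poisson_weights scale br A" "a \<in> weight_space br A l"
  shows "poisson_normal br A a"
  using assms by (auto simp: poisson_normal_def poisson_weights_def poisson_derivation_def
      derivation_on_def weight_space_def)

text \<open>By the Leibniz rule the cofactors of the two factors add up. Closure under products and
  scalars, together with normality of 1, reduces the generated subalgebra to sums of normal
  elements.\<close>

lemma poisson_normal_mult:
  assumes "poisson_normal br A a" "poisson_normal br A b"
  shows "poisson_normal br A (a * b)"
  unfolding poisson_normal_def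
proof (intro conjI ballI)
  have ab: "a \<in> A" "b \<in> A" using assms by (auto simp: poisson_normal_def)
  then show "a * b \<in> A" by (rule carrier_mult)
  fix x assume x: "x \<in> A"
  obtain c where c: "c \<in> A" "br x a = c * a" using assms(1) x by (auto simp: poisson_normal_def)
  obtain d where d: "d \<in> A" "br x b = d * b" using assms(2) x by (auto simp: poisson_normal_def)
  have "br x (a * b) = (c + d) * (a * b)"
    using ab x c d by (simp add: br_mult_right algebra_simps)
  then show "\<exists>c\<in>A. br x (a * b) = c * (a * b)" using c d carrier_add by blast
qed

lemma poisson_normal_scale:
  assumes "poisson_normal br A a" shows "poisson_normal br A (scale k a)"
  unfolding poisson_normal_def
proof (intro conjI ballI)
  have a: "a \<in> A" using assms by (simp add: poisson_normal_def)
  then show "scale k a \<in> A" by (rule carrier_scale)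
  fix x assume x: "x \<in> A"
  obtain c where c: "c \<in> A" "br x a = c * a" using assms x by (auto simp: poisson_normal_def)
  have "br x (scale k a) = c * scale k a"
    using a x c by (simp add: br_scale_right scale_mult_left mult.commute[of c])
  then show "\<exists>c\<in>A. br x (scale k a) = c * scale k a" using c by blast
qed

lemma poisson_normal_one: "poisson_normal br A 1"
  by (auto simp: poisson_normal_def carrier_one br_one carrier_zero)

text \<open>
  The number of summands is recorded by the length of the list, which is what the minimality
  argument below descends on.
\<close>

lemma poisson_semi_centre_eq:
  "poisson_semi_centre scale br A = {sum_list xs | xs. \<forall>a\<in>set xs. poisson_normal br A a}"
  (is "_ = ?S")
proof
  have mem: "\<And>xs. \<forall>a\<in>set xs. poisson_normal br A a \<Longrightarrow> sum_list xs \<in> ?S" by blast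
  have "subalgebra scale ?S"
    unfolding subalgebra_def subspace_def
  proof (intro conjI ballI allI)
    show "0 \<in> ?S" using mem[of "[]"] by simp
    show "1 \<in> ?S" using mem[of "[1]"] poisson_normal_one by simp
    fix x assume "x \<in> ?S"
    then obtain xs where xs: "x = sum_list xs" "\<forall>a\<in>set xs. poisson_normal br A a" by blast
    show "scale c x \<in> ?S" for c
    proof -
      have "scale c (sum_list xs) = sum_list (map (scale c) xs)"
        by (induction xs) (auto simp: scale_right_distrib)
      then show ?thesis
        using xs mem[of "map (scale c) xs"] poisson_normal_scale by simp
    qed
    fix y assume "y \<in> ?S"
    then obtain ys where ys: "y = sum_list ys" "\<forall>a\<in>set ys. poisson_normal br A a" by blast
    show "x + y \<in> ?S" using mem[of "xs @ ys"] xs ys by auto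
    have "x * y = sum_list [a * b. a \<leftarrow> xs, b \<leftarrow> ys]"
      unfolding xs(1) ys(1)
      by (induction xs) (simp_all add: distrib_right sum_list_const_mult)
    moreover have "\<forall>z\<in>set [a * b. a \<leftarrow> xs, b \<leftarrow> ys]. poisson_normal br A z"
      using xs ys poisson_normal_mult by auto
    ultimately show "x * y \<in> ?S" by blast
  qed
  moreover have "{a. poisson_normal br A a} \<subseteq> ?S"
    using mem[of "[_]"] by auto
  ultimately show "poisson_semi_centre scale br A \<subseteq> ?S"
    unfolding poisson_semi_centre_def by (intro hull_minimal)
next
  show "?S \<subseteq> poisson_semi_centre scale br A"
  proof clarify
    fix xs assume xs: "\<forall>a\<in>set xs. poisson_normal br A a"
    have "sum_list xs \<in> T" if T: "subalgebra scale T" "{a. poisson_normal br A a} \<subseteq> T" for T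
      using xs
    proof (induction xs)
      case Nil
      then show ?case using T by (auto simp: subalgebra_def subspace_def)
    next
      case (Cons a xs)
      then have "a \<in> T" "sum_list xs \<in> T" using T(2) by auto
      then show ?case using T(1) by (simp add: subalgebra_def subspace_def)
    qed
    then show "sum_list xs \<in> poisson_semi_centre scale br A"
      unfolding poisson_semi_centre_def hull_def by blast
  qed
qed

end

section \<open>Weights of normal elements in an integral Poisson algebra\<close>

context integral_poisson_algebra
begin

text \<open>In a domain the cofactor of a nonzero \<open>a\<close> is unique, so sending
  \<open>b\<close> to the cofactor of \<open>br b a\<close> determines a map \<open>l\<close> on
  \<open>A\<close>. Identities for brackets with \<open>a\<close> descend to \<open>l\<close> on
  cancelling \<open>a\<close>: linearity and Leibniz make \<open>l\<close> a derivation, Jacobi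
  makes it a Poisson derivation.\<close>

lemma poisson_normal_obtains_weight:
  assumes "poisson_normal br A a"
  obtains l where "l \<in> poisson_weights scale br A" "a \<in> weight_space br A l"
proof -
  have aux: "\<exists>l\<in>poisson_weights scale br A. a \<in> weight_space br A l"
    if a: "poisson_normal br A a" "a \<noteq> 0" for a
  proof -
    have aA: "a \<in> A" using a by (simp add: poisson_normal_def)
    obtain l where lA: "\<And>b. b \<in> A \<Longrightarrow> l b \<in> A" and l: "\<And>b. b \<in> A \<Longrightarrow> br b a = l b * a"
      using a(1) unfolding poisson_normal_def by metis
    have cancel: "x = y" if "x * a = y * a" for x y using that a(2) by simp
    have "derivation_on scale A l"
      unfolding derivation_on_def
    proof (intro conjI ballI allI)
      fix x assume x: "x \<in> A"
      show "l x \<in> A" by (rule lA[OF x])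
      show "l (scale c x) = scale c (l x)" for c
        by (rule cancel)
          (use x aA in \<open>simp add: carrier_scale br_scale_left scale_mult_left flip: l\<close>)
      fix y assume y: "y \<in> A"
      show "l (x + y) = l x + l y"
        by (rule cancel)
          (use x y aA in \<open>simp add: carrier_add br_add_left distrib_right flip: l\<close>)
      have "l (x * y) * a = br x a * y + x * br y a"
        using x y aA by (simp add: carrier_mult br_mult_left flip: l)
      then have "l (x * y) * a = (l x * y + x * l y) * a"
        using x y by (simp add: l algebra_simps)
      then show "l (x * y) = l x * y + x * l y" by (rule cancel)
    qed
    moreover have "l (br x y) = br (l x) y + br x (l y)" if xy: "x \<in> A" "y \<in> A" for x y
    proof (rule cancel)
      have "l (br x y) * a = br (br x y) a" using xy by (simp add: l br_closed)
      also have "\<dots> = br x (l y * a) - br y (l x * a)"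
        using br_br[OF xy(1,2) aA] xy by (simp add: l)
      \<comment> \<open>Both Leibniz expansions also produce \<open>l x * l y * a\<close>, which
        cancels.\<close>
      also have "\<dots> = br x (l y) * a - br y (l x) * a"
        using xy aA by (simp add: br_mult_right lA l algebra_simps)
      also have "\<dots> = (br (l x) y + br x (l y)) * a"
        using xy by (simp add: br_antisym[of y "l x"] lA algebra_simps)
      finally show "l (br x y) * a = (br (l x) y + br x (l y)) * a" .
    qed
    moreover have "a \<in> weight_space br A l" using l aA by (simp add: weight_space_def)
    ultimately show ?thesis
      using a(2) unfolding poisson_weights_def poisson_derivation_def by blast
  qed
  show thesis
  proof (cases "a = 0")
    case True
    \<comment> \<open>Zero lies in every weight space, so any weight serves; the normal element 1
      shows that one exists.\<close>
    obtain l where "l \<in> poisson_weights scale br A"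
      using aux[OF poisson_normal_one] by auto
    moreover have "0 \<in> weight_space br A l"
      by (auto simp: weight_space_def carrier_zero br_zero_right)
    ultimately show thesis using that True by blast
  next
    case False
    then show thesis using aux[OF assms] that by blast
  qed
qed

text \<open>
  Commuting weights make \<open>br b a = l b * a\<close> homogeneous of weight \<open>l + m\<close>; cancelling \<open>a\<close>
  leaves \<open>l b\<close> of weight \<open>m\<close>.
\<close>

lemma weight_maps_weight_space:
  assumes ab: "abelian_weight_property scale br A"
    and l: "l \<in> poisson_weights scale br A" and m: "m \<in> poisson_weights scale br A"
    and b: "b \<in> weight_space br A m"
  shows "l b \<in> weight_space br A m"
proof -
  \<comment> \<open>A weight is only required to have a weight space different from
    \<open>{0}\<close>; as 0 belongs to it, a nonzero element follows.\<close>
  have "0 \<in> weight_space br A l"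
    by (auto simp: weight_space_def carrier_zero br_zero_right)
  then obtain a where a: "a \<in> weight_space br A l" "a \<noteq> 0"
    using l unfolding poisson_weights_def by blast
  have lder: "derivation_on scale A l" and mder: "derivation_on scale A m"
    using l m by (auto simp: poisson_weights_def poisson_derivation_def)
  have aA: "a \<in> A" and bA: "b \<in> A" using a b by (auto simp: weight_space_def)
  have lA: "\<And>x. x \<in> A \<Longrightarrow> l x \<in> A" and mA: "\<And>x. x \<in> A \<Longrightarrow> m x \<in> A"
    using lder mder by (auto simp: derivation_on_def)
  have la: "\<And>x. x \<in> A \<Longrightarrow> br x a = l x * a" and mb: "\<And>x. x \<in> A \<Longrightarrow> br x b = m x * b"
    using a b by (auto simp: weight_space_def)
  have "br c (l b) = m c * l b" if c: "c \<in> A" for c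
  proof -
    have comm: "l (m c) = m (l c)"
      using ab l m c by (auto simp: abelian_weight_property_def)
    \<comment> \<open>Here \<open>l b * a\<close> is \<open>br b a\<close>. Its bracket with
      \<open>c\<close> is computed by Jacobi first and by Leibniz at the end of the chain; comparing
      the two isolates \<open>br c (l b)\<close> up to the factor \<open>a\<close>.\<close>
    have "br c (l b * a) = br (m c * b) a + br b (l c * a)"
      using br_br[OF c bA aA] c bA by (simp add: la mb)
    also have "br (m c * b) a = (l (m c) * b + m c * l b) * a"
      using c bA mA carrier_mult lder by (simp add: la derivation_on_def)
    also have "br b (l c * a) = - (m (l c) * b) * a + l c * (l b * a)"
      using br_antisym[of "l c" b] c bA aA lA by (simp add: br_mult_right la mb)
    also have "br c (l b * a) = br c (l b) * a + l b * (l c * a)"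
      using c bA aA lA by (simp add: br_mult_right la)
    finally have "br c (l b) * a = (m c * l b) * a"
      by (simp add: comm algebra_simps)
    then show ?thesis using a(2) by simp
  qed
  then show ?thesis using lA bA by (simp add: weight_space_def)
qed

section \<open>The semi-centre as a Poisson subalgebra stable under the weights\<close>

lemma semi_centre_subset: "poisson_semi_centre scale br A \<subseteq> A"
  unfolding poisson_semi_centre_def
  by (rule hull_minimal) (auto simp: subalgebra_carrier poisson_normal_def)

lemma poisson_normal_in_semi_centre:
  "poisson_normal br A a \<Longrightarrow> a \<in> poisson_semi_centre scale br A"
  unfolding poisson_semi_centre_def by (auto intro: hull_inc)

lemma subalgebra_semi_centre: "subalgebra scale (poisson_semi_centre scale br A)"
  unfolding poisson_semi_centre_def
  by (rule hull_in) (auto simp: subalgebra_def subspace_def)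

text \<open>Reduces an additive claim about the semi-centre to normal elements, where weights are
  available.\<close>

lemma semi_centre_induct [consumes 1, case_names zero add]:
  assumes "x \<in> poisson_semi_centre scale br A"
    and "P 0"
    and "\<And>a y. \<lbrakk>poisson_normal br A a; y \<in> poisson_semi_centre scale br A; P y\<rbrakk> \<Longrightarrow> P (a + y)"
  shows "P x"
proof -
  obtain xs where "x = sum_list xs" "\<forall>a\<in>set xs. poisson_normal br A a"
    using assms(1) by (auto simp: poisson_semi_centre_eq)
  then show ?thesis
  proof (induction xs arbitrary: x)
    case (Cons a xs)
    then have "sum_list xs \<in> poisson_semi_centre scale br A"
      by (auto simp: poisson_semi_centre_eq)
    with Cons show ?case using assms(3)[of a "sum_list xs"] by simp
  qed (use assms(2) in simp)
qed

text \<open>A normal summand of weight \<open>m\<close> is sent to an element of weight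
  \<open>m\<close>, which is again normal. Stability lets weights of \<open>A\<close> restrict to
  the semi-centre and keeps cofactors inside it.\<close>

lemma weight_maps_semi_centre:
  assumes ab: "abelian_weight_property scale br A" and l: "l \<in> poisson_weights scale br A"
    and x: "x \<in> poisson_semi_centre scale br A"
  shows "l x \<in> poisson_semi_centre scale br A"
proof -
  have lder: "derivation_on scale A l"
    using l by (simp add: poisson_weights_def poisson_derivation_def)
  have ladd: "l (y + z) = l y + l z" if "y \<in> A" "z \<in> A" for y z
    using lder that by (simp add: derivation_on_def)
  show ?thesis
    using x
  proof (induction rule: semi_centre_induct)
    case zero
    have "l 0 = 0" using ladd[of 0 0] carrier_zero by (metis add_0 add_cancel_left_left)
    then show ?case using subalgebra_semi_centre by (simp add: subalgebra_def subspace_def)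
  next
    case (add a y)
    obtain m where m: "m \<in> poisson_weights scale br A" "a \<in> weight_space br A m"
      using poisson_normal_obtains_weight[OF add(1)] .
    have "l a \<in> poisson_semi_centre scale br A"
      using weight_maps_weight_space[OF ab l m] poisson_normal_weight_space[OF m(1)]
        poisson_normal_in_semi_centre by blast
    moreover have "l (a + y) = l a + l y"
      using add(1,2) semi_centre_subset by (intro ladd) (auto simp: poisson_normal_def)
    ultimately show ?case
      using add(3) subalgebra_semi_centre by (simp add: subalgebra_def subspace_def)
  qed
qed

text \<open>Only the second argument needs decomposing: against a normal \<open>a\<close> of weight
  \<open>m\<close> the bracket is \<open>m x * a\<close>, and \<open>m x\<close> stays in the
  semi-centre.\<close>

lemma br_semi_centre_closed:
  assumes ab: "abelian_weight_property scale br A"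
    and x: "x \<in> poisson_semi_centre scale br A" and y: "y \<in> poisson_semi_centre scale br A"
  shows "br x y \<in> poisson_semi_centre scale br A"
  using y
proof (induction rule: semi_centre_induct)
  case zero
  show ?case
    using subalgebra_semi_centre x semi_centre_subset
    by (auto simp: br_zero_right subalgebra_def subspace_def)
next
  case (add a y)
  obtain m where m: "m \<in> poisson_weights scale br A" "a \<in> weight_space br A m"
    using poisson_normal_obtains_weight[OF add(1)] .
  have A: "x \<in> A" "y \<in> A" "a \<in> A"
    using x add(1,2) semi_centre_subset by (auto simp: poisson_normal_def)
  have "br x a = m x * a" using weight_spaceD(2)[OF m(2) A(1)] .
  then show ?case
    using A add(3) weight_maps_semi_centre[OF ab m(1) x] poisson_normal_in_semi_centre[OF add(1)]
      subalgebra_semi_centre by (simp add: br_add_right subalgebra_def subspace_def)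
qed

text \<open>Applied to the semi-centre, this makes the fraction field construction available with
  the semi-centre as carrier.\<close>

lemma integral_poisson_algebra_subalgebra:
  assumes B: "subalgebra scale B" "B \<subseteq> A" and br: "\<And>x y. \<lbrakk>x \<in> B; y \<in> B\<rbrakk> \<Longrightarrow> br x y \<in> B"
  shows "integral_poisson_algebra scale br B"
proof unfold_locales
  show "derivation_on scale B (br b)" if "b \<in> B" for b
    using that br derivation_right[of b] B(2) unfolding derivation_on_def by blast
  show "derivation_on scale B (\<lambda>a. br a b)" if "b \<in> B" for b
    using that br derivation_left[of b] B(2) unfolding derivation_on_def by blast
  show "br a a = 0" if "a \<in> B" for a using that B(2) br_self by blast
  show "br a (br b c) + br b (br c a) + br c (br a b) = 0"
    if "a \<in> B" "b \<in> B" "c \<in> B" for a b c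
    using that B(2) jacobi by blast
qed (rule B(1))

section \<open>Weight vectors in Poisson ideals of the semi-centre\<close>

text \<open>The ideal is stable only under brackets with the semi-centre, so minimality can be
  tested only there. Hence \<open>l\<close> is a weight of \<open>A\<close>, but the equation for
  \<open>x\<close> is obtained just for \<open>b\<close> in the semi-centre.\<close>

lemma poisson_ideal_semi_centre_obtains_weight_vector:
  assumes ab: "abelian_weight_property scale br A"
    and I: "poisson_ideal br (poisson_semi_centre scale br A) I" "I \<noteq> {0}"
  obtains x l where "x \<in> I" "x \<noteq> 0" "l \<in> poisson_weights scale br A"
    "\<And>b. b \<in> poisson_semi_centre scale br A \<Longrightarrow> br b x = l b * x"
proof -
  let ?B = "poisson_semi_centre scale br A"
  let ?W = "poisson_weights scale br A"
  \<comment> \<open>Entries may vanish or share a weight; only the length of the list is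
    minimised.\<close>
  define P where "P xs \<longleftrightarrow> sum_list xs \<in> I \<and> sum_list xs \<noteq> 0 \<and>
    (\<forall>a\<in>set xs. poisson_normal br A a)" for xs
  have "\<exists>xs. P xs"
  proof -
    obtain x where "x \<in> I" "x \<noteq> 0" using I by (auto simp: poisson_ideal_def)
    moreover have "x \<in> ?B" using \<open>x \<in> I\<close> I by (auto simp: poisson_ideal_def)
    ultimately show ?thesis by (auto simp: P_def poisson_semi_centre_eq)
  qed
  then obtain xs where xs: "P xs" and min: "\<And>ys. P ys \<Longrightarrow> length xs \<le> length ys"
    using ex_has_least_nat[of P _ length] by metis
  obtain a ys where xs_eq: "xs = a # ys" using xs by (cases xs) (auto simp: P_def)
  define x where "x = sum_list xs"
  have "poisson_normal br A a" using xs xs_eq by (simp add: P_def)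
  then obtain l where l: "l \<in> ?W" "a \<in> weight_space br A l"
    by (rule poisson_normal_obtains_weight)
  have xI: "x \<in> I" and xn: "x \<noteq> 0" using xs by (auto simp: P_def x_def)
  have BA: "?B \<subseteq> A" by (rule semi_centre_subset)
  have xA: "x \<in> A" using xI I(1) BA by (auto simp: poisson_ideal_def)
  have hom: "br b x = l b * x" if b: "poisson_normal br A b" for b
  proof (rule ccontr)
    assume neq: "br b x \<noteq> l b * x"
    have bB: "b \<in> ?B" using b by (rule poisson_normal_in_semi_centre)
    have bA: "b \<in> A" using bB BA by blast
    obtain m where m: "m \<in> ?W" "b \<in> weight_space br A m"
      using b by (rule poisson_normal_obtains_weight)
    \<comment> \<open>An entry \<open>u\<close> of weight \<open>n\<close> becomes
      \<open>(n b - l b) * u\<close>. It is normal because \<open>n b\<close> and \<open>l b\<close>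
      both have the weight \<open>m\<close> of \<open>b\<close>, hence so does their difference. On
      the tail \<open>ys\<close> this gives a list shorter than \<open>xs\<close>.\<close>
    have shrink: "\<exists>zs. length zs = length us \<and> (\<forall>z\<in>set zs. poisson_normal br A z) \<and>
        sum_list us \<in> A \<and> br b (sum_list us) - l b * sum_list us = sum_list zs"
      if "\<forall>u\<in>set us. poisson_normal br A u" for us
      using that
    proof (induction us)
      case Nil
      then show ?case using bA by (simp add: br_zero_right carrier_zero)
    next
      case (Cons u us)
      then obtain zs where zs: "length zs = length us" "\<forall>z\<in>set zs. poisson_normal br A z"
        "sum_list us \<in> A" "br b (sum_list us) - l b * sum_list us = sum_list zs"
        by auto
      have u: "poisson_normal br A u" using Cons by simp
      then obtain n where n: "n \<in> ?W" "u \<in> weight_space br A n"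
        by (rule poisson_normal_obtains_weight)
      have "n b - l b \<in> weight_space br A m"
        using weight_maps_weight_space[OF ab _ m] n(1) l(1) weight_space_diff by blast
      then have "poisson_normal br A ((n b - l b) * u)"
        using poisson_normal_weight_space[OF m(1)] poisson_normal_mult u by blast
      moreover have "u \<in> A" "br b u = n b * u" using weight_spaceD[OF n(2)] bA by auto
      ultimately show ?case
        using zs bA
        by (intro exI[of _ "(n b - l b) * u # zs"])
          (auto simp: br_add_right carrier_add algebra_simps)
    qed
    obtain zs where zs: "length zs = length ys" "\<forall>z\<in>set zs. poisson_normal br A z"
      "sum_list ys \<in> A" "br b (sum_list ys) - l b * sum_list ys = sum_list zs"
      using shrink[of ys] xs xs_eq by (auto simp: P_def)
    have "a \<in> A" "br b a = l b * a" using weight_spaceD[OF l(2)] bA by auto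
    then have eq: "br b x - l b * x = sum_list zs"
      using zs bA by (simp add: x_def xs_eq br_add_right algebra_simps)
    have lb: "l b \<in> ?B" by (rule weight_maps_semi_centre[OF ab l(1) bB])
    \<comment> \<open>A Poisson ideal is given by closure under sums and multiples, so the
      difference is formed as a sum with a multiple by -1.\<close>
    have "- 1 \<in> ?B"
      using subalgebra_semi_centre subspace_neg by (auto simp: subalgebra_def)
    then have "br b x + - 1 * (l b * x) \<in> I"
      using I(1) xI bB lb unfolding poisson_ideal_def by blast
    then have "sum_list zs \<in> I" unfolding eq[symmetric] by simp
    moreover have "sum_list zs \<noteq> 0" unfolding eq[symmetric] using neq by simp
    ultimately have "P zs" using zs(2) by (simp add: P_def)
    then show False using min[of zs] zs(1) xs_eq by simp
  qed
  have ladd: "\<And>y z. \<lbrakk>y \<in> A; z \<in> A\<rbrakk> \<Longrightarrow> l (y + z) = l y + l z"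
    using l(1) by (auto simp: poisson_weights_def poisson_derivation_def derivation_on_def)
  \<comment> \<open>Both sides are additive in \<open>b\<close>, so the case of normal
    \<open>b\<close> suffices.\<close>
  have "br b x = l b * x" if "b \<in> ?B" for b
    using that
  proof (induction rule: semi_centre_induct)
    case zero
    have "l 0 = 0" using ladd[of 0 0] carrier_zero by (metis add_0 add_cancel_left_left)
    then show ?case using xA by (simp add: br_zero_left)
  next
    case (add c y)
    then have "c \<in> A" "y \<in> A" using BA by (auto simp: poisson_normal_def)
    then show ?case using add hom[of c] xA by (simp add: br_add_left ladd distrib_right)
  qed
  then show thesis using that xI xn l(1) by blast
qed

end

section \<open>The denominators of a rational Casimir\<close>

text \<open>A Casimir \<open>q\<close> behaves as a constant for the extended bracket: bracketing
  the numerator equation with \<open>c\<close> leaves \<open>q\<close> untouched. So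
  \<open>br c b\<close> is a denominator with numerator \<open>br c a\<close>, and the second claim
  later transfers the weight of a denominator to its numerator.\<close>

lemma (in integral_poisson_algebra) poisson_ideal_casimir_denominators:
  assumes "q \<in> rational_casimirs scale br A"
  shows "poisson_ideal br A {b\<in>A. \<exists>a\<in>A. to_fract a = to_fract b * q}"
    and "\<lbrakk>a \<in> A; b \<in> A; c \<in> A; to_fract a = to_fract b * q\<rbrakk> \<Longrightarrow>
      to_fract (br c a) = to_fract (br c b) * q"
proof -
  define F where "F = frac_bracket scale br A"
  have F: "frac_bracket_of scale br A F"
    unfolding F_def frac_bracket_def by (rule theI'[OF frac_bracket_ex1])
  interpret F: poisson_algebra "frac_scale scale" F FA
    using F by (simp add: frac_bracket_of_def)
  have q: "q \<in> FA" "\<And>p. p \<in> FA \<Longrightarrow> F p q = 0"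
    using assms by (auto simp: rational_casimirs_def poisson_centre_def F_def)
  have Fto: "\<And>a b. \<lbrakk>a \<in> A; b \<in> A\<rbrakk> \<Longrightarrow> F (to_fract a) (to_fract b) = to_fract (br a b)"
    using F by (simp add: frac_bracket_of_def)
  show br: "to_fract (br c a) = to_fract (br c b) * q"
    if "a \<in> A" "b \<in> A" "c \<in> A" "to_fract a = to_fract b * q" for a b c
  proof -
    have "to_fract (br c a) = F (to_fract c) (to_fract b * q)"
      using that by (simp flip: Fto)
    also have "\<dots> = to_fract (br c b) * q"
      using that q by (simp add: F.br_mult_right FA_to_fract Fto)
    finally show ?thesis .
  qed
  show "poisson_ideal br A {b\<in>A. \<exists>a\<in>A. to_fract a = to_fract b * q}"
    unfolding poisson_ideal_def
  proof (intro conjI ballI)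
    show "0 \<in> {b\<in>A. \<exists>a\<in>A. to_fract a = to_fract b * q}"
      using carrier_zero by (auto intro!: bexI[of _ 0])
    fix x assume "x \<in> {b\<in>A. \<exists>a\<in>A. to_fract a = to_fract b * q}"
    then obtain x' where x: "x \<in> A" "x' \<in> A" "to_fract x' = to_fract x * q" by blast
    show "y * x \<in> {b\<in>A. \<exists>a\<in>A. to_fract a = to_fract b * q}" if "y \<in> A" for y
      using x that by (auto simp: carrier_mult intro!: bexI[of _ "y * x'"])
    show "br y x \<in> {b\<in>A. \<exists>a\<in>A. to_fract a = to_fract b * q}" if "y \<in> A" for y
      using x that br[of x' x y] by (auto simp: br_closed intro!: bexI[of _ "br y x'"])
    fix y assume "y \<in> {b\<in>A. \<exists>a\<in>A. to_fract a = to_fract b * q}"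
    then obtain y' where y: "y \<in> A" "y' \<in> A" "to_fract y' = to_fract y * q" by blast
    show "x + y \<in> {b\<in>A. \<exists>a\<in>A. to_fract a = to_fract b * q}"
      using x y by (auto simp: carrier_add distrib_right intro!: bexI[of _ "x' + y'"])
  qed blast
qed

section \<open>Normal elements in ideals and rational Casimirs of the semi-centre\<close>

theorem proposition1p1:
  fixes scale :: "'k::field_char_0 \<Rightarrow> 'a::idom \<Rightarrow> 'a"
    and br :: "'a \<Rightarrow> 'a \<Rightarrow> 'a" and A Asc :: "'a set"
  assumes "integral_poisson_algebra scale br A"
    and "abelian_weight_property scale br A"
    and "Asc = poisson_semi_centre scale br A"
    and "finitely_generated_algebra scale Asc"
  shows "(\<forall>I. poisson_ideal br Asc I \<and> I \<noteq> {0} \<longrightarrow>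
            (\<exists>a\<in>I. a \<noteq> 0 \<and> poisson_normal br Asc a)) \<and>
         (\<forall>q\<in>rational_casimirs scale br Asc.
            \<exists>l a b. poisson_derivation scale br Asc l \<and>
              a \<in> Asc \<and> b \<in> Asc \<and> b \<noteq> 0 \<and>
              (\<forall>c\<in>Asc. br c a = l c * a) \<and> (\<forall>c\<in>Asc. br c b = l c * b) \<and>
              q = to_fract a * inverse (to_fract b))"
proof -
  interpret A: integral_poisson_algebra scale br A by (rule assms(1))
  note ab = assms(2)
  have AscA: "Asc \<subseteq> A" unfolding assms(3) by (rule A.semi_centre_subset)
  interpret B: integral_poisson_algebra scale br Asc
    using A.integral_poisson_algebra_subalgebra[OF A.subalgebra_semi_centre A.semi_centre_subset
        A.br_semi_centre_closed[OF ab]] by (simp add: assms(3))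
  have lB: "l x \<in> Asc" if "l \<in> poisson_weights scale br A" "x \<in> Asc" for l x
    using A.weight_maps_semi_centre[OF ab] that assms(3) by blast
  show ?thesis
  proof (intro conjI allI impI ballI)
    fix I assume I: "poisson_ideal br Asc I \<and> I \<noteq> {0}"
    then obtain x l where x: "x \<in> I" "x \<noteq> 0" "l \<in> poisson_weights scale br A"
      "\<And>b. b \<in> Asc \<Longrightarrow> br b x = l b * x"
      using A.poisson_ideal_semi_centre_obtains_weight_vector[OF ab, folded assms(3)] by metis
    \<comment> \<open>Normality in \<open>Asc\<close> needs cofactors in \<open>Asc\<close>;
      \<open>lB\<close> places \<open>l b\<close> there.\<close>
    have "poisson_normal br Asc x"
      unfolding poisson_normal_def using x I lB by (auto simp: poisson_ideal_def)
    then show "\<exists>a\<in>I. a \<noteq> 0 \<and> poisson_normal br Asc a" using x by blast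
  next
    fix q assume q: "q \<in> rational_casimirs scale br Asc"
    define I where "I = {b\<in>Asc. \<exists>a\<in>Asc. to_fract a = to_fract b * q}"
    have "q \<in> frac_carrier Asc" using q by (simp add: rational_casimirs_def poisson_centre_def)
    then obtain c d where cd: "c \<in> Asc" "d \<in> Asc" "d \<noteq> 0" "q = to_fract c / to_fract d"
      by (rule B.FA_E)
    then have "d \<in> I" unfolding I_def by (auto intro!: bexI[of _ c])
    then have "I \<noteq> {0}" using cd(3) by blast
    then obtain b l where b: "b \<in> I" "b \<noteq> 0" and l: "l \<in> poisson_weights scale br A"
      "\<And>c. c \<in> Asc \<Longrightarrow> br c b = l c * b"
      using A.poisson_ideal_semi_centre_obtains_weight_vector[OF ab, folded assms(3)]
        B.poisson_ideal_casimir_denominators(1)[OF q, folded I_def] by metis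
    then obtain a where a: "a \<in> Asc" "to_fract a = to_fract b * q" and bB: "b \<in> Asc"
      unfolding I_def by blast
    \<comment> \<open>The numerator inherits the weight: \<open>br c a\<close> equals
      \<open>br c b\<close> times \<open>q\<close>, that is \<open>l c * b\<close> times
      \<open>q\<close>, which is \<open>l c * a\<close>.\<close>
    have "br c a = l c * a" if c: "c \<in> Asc" for c
    proof -
      have "to_fract (br c a) = to_fract (l c * a)"
        using B.poisson_ideal_casimir_denominators(2)[OF q a(1) bB c a(2)] l(2)[OF c] a(2)
        by (simp add: mult.assoc)
      then show ?thesis by (simp only: to_fract_eq_iff)
    qed
    moreover have "poisson_derivation scale br Asc l"
    proof -
      \<comment> \<open>The identities restrict from \<open>A\<close> to \<open>Asc\<close>; that
        \<open>l\<close> maps \<open>Asc\<close> into itself comes from \<open>lB\<close>.\<close>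
      have "poisson_derivation scale br A l" using l(1) by (simp add: poisson_weights_def)
      then show ?thesis
        using AscA lB[OF l(1)] unfolding poisson_derivation_def derivation_on_def by blast
    qed
    moreover have "q = to_fract a * inverse (to_fract b)"
      using a(2) b(2) by (simp add: field_simps)
    ultimately show "\<exists>l a b. poisson_derivation scale br Asc l \<and>
        a \<in> Asc \<and> b \<in> Asc \<and> b \<noteq> 0 \<and>
        (\<forall>c\<in>Asc. br c a = l c * a) \<and> (\<forall>c\<in>Asc. br c b = l c * b) \<and>
        q = to_fract a * inverse (to_fract b)"
      using a(1) bB b(2) l(2) by blast
  qed
qed

end
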